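(* Let $\theta_t=\sum_{i\ge0}\theta_it^i$ be a formal $1$-parameter deformation of a left-symmetric conformal algebra $A$. Then $\theta_1$ is a $2$-cocycle of $A$ with coefficients in the adjoint module. Furthermore, the cohomology class of $\theta_1$ in $H^2(A,A)$ depends only on the equivalence class of the deformation $\theta_t$; that is, if $\theta_t$ and $\theta'_t$ are equivalent formal $1$-parameter deformations of $A$, then $\theta_1$ and $\theta'_1$ define the same class in $H^2(A,A)$.
   Context: $A$ is finitely generated as a $\mathbb{C}[\partial]$-module. Products and cochains are extended coefficientwise to polynomials in $\lambda,\mu$. A left-symmetric conformal algebra is a $\mathbb{C}[\partial]$-module $A$ with a $\mathbb{C}$-linear map $A\otimes A\to A[\lambda]$, $a\otimes b\mapsto a_\lambda b$, such that $(\partial a)_\lambda b=-\lambda a_\lambda b$, $a_\lambda(\partial b)=(\partial+\lambda)a_\lambda b$ and $(a_\lambda b)_{\lambda+\mu}c-a_\lambda(b_\mu c)=(b_\mu a)_{\lambda+\mu}c-b_\mu(a_\lambda c)$. The adjoint module is $A$ with left and right actions given by the $\lambda$-product. $C^1(A,A)$ is the space of $\mathbb{C}[\partial]$-module homomorphisms $A\to A$. $C^2(A,A)$ is the space of $\mathbb{C}$-bilinear maps $\omega_\lambda:A\times A\to A[\lambda]$ with $\omega_\lambda(\partial a,b)=-\lambda\omega_\lambda(a,b)$ and $\omega_\lambda(a,\partial b)=(\partial+\lambda)\omega_\lambda(a,b)$. For $\phi\in C^1(A,A)$, $(\delta\phi)_\lambda(a,b)=a_\lambda\phi(b)+\phi(a)_\lambda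 b-\phi(a_\lambda b)$. For $\omega\in C^2(A,A)$, $$(\delta\omega)_{\lambda,\mu}(a,b,c)=a_\lambda\omega_\mu(b,c)-b_\mu\omega_\lambda(a,c)+\omega_\mu(b,a)_{\lambda+\mu}c-\omega_\lambda(a,b)_{\lambda+\mu}c-\omega_\mu(b,a_\lambda c)+\omega_\lambda(a,b_\mu c)-\omega_{\lambda+\mu}(a_\lambda b,c)+\omega_{\lambda+\mu}(b_\mu a,c).$$ A 2-cocycle is an $\omega\in C^2(A,A)$ with $\delta\omega=0$, and $H^2(A,A)$ is the quotient of the space of 2-cocycles by $\delta C^1(A,A)$. A formal $1$-parameter deformation of $A$ is a formal power series $\theta_t=\sum_{i\ge0}\theta_it^i$ with $\theta_i\in C^2(A,A)$, ${\theta_0}_\lambda(a,b)=a_\lambda b$, defining a left-symmetric conformal algebra structure on formal power series in $t$ with coefficients in $A$, i.e. for all $n\ge0$ and $a,b,c\in A$ $$\sum_{i+j=n}\big({\theta_i}_{\lambda+\mu}({\theta_j}_\lambda(a,b),c)-{\theta_i}_\lambda(a,{\theta_j}_\mu(b,c))\big)=\sum_{i+j=n}\big({\theta_i}_{\lambda+\mu}({\theta_j}_\mu(b,a),c)-{\theta_i}_\mu(b,{\theta_j}_\lambda(a,c))\big).$$ Two such deformations $\theta_t,\theta'_t$ are equivalent if there is a formal power series $\phi_t=\sum_{i\ge0}\phi_it^i$ with $\phi_i\in C^1(A,A)$, $\phi_0=\mathrm{id}_A$, which is a morphism from the structure $\theta'_t$ to the structure $\theta_t$, i.e. for all $n\ge0$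 and $a,b\in A$: $\sum_{i+j=n}\phi_i({\theta'_j}_\lambda(a,b))=\sum_{i+j+k=n}{\theta_i}_\lambda(\phi_j(a),\phi_k(b))$. *)

theory Defs
  imports Complex_Main "HOL-Computational_Algebra.Polynomial"
begin

text \<open>
  A \<open>\<complex>[\<partial>]\<close>-module structure on the abelian group \<open>'a\<close> is given by a scalar multiplication
  \<open>sc\<close> with \<open>module sc\<close>; \<open>\<partial>\<close> acts as the indeterminate \<open>[:0, 1:]\<close> and \<open>\<complex>\<close> acts through the
  constant polynomials. \<open>A[\<lambda>]\<close> is the type \<open>'a poly\<close>.
\<close>

definition fin_gen_module :: "(complex poly \<Rightarrow> 'a::ab_group_add \<Rightarrow> 'a) \<Rightarrow> bool" where
  "fin_gen_module sc \<longleftrightarrow> module sc \<and> (\<exists>S. finite S \<and> module.span sc S = UNIV)"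

abbreviation der :: "(complex poly \<Rightarrow> 'a::ab_group_add \<Rightarrow> 'a) \<Rightarrow> 'a \<Rightarrow> 'a" where
  "der sc \<equiv> sc [:0, 1:]"

abbreviation cscale :: "(complex poly \<Rightarrow> 'a::ab_group_add \<Rightarrow> 'a) \<Rightarrow> complex \<Rightarrow> 'a \<Rightarrow> 'a" where
  "cscale sc \<equiv> (\<lambda>c. sc [:c:])"

text \<open>
  \<open>w a b\<close> stands for \<open>w\<^sub>\<lambda>(a,b)\<close>. Multiplication by \<open>\<lambda>\<close> in \<open>A[\<lambda>]\<close> is \<open>pCons 0\<close>.
\<close>

type_synonym 'a lambda_map = "'a \<Rightarrow> 'a \<Rightarrow> 'a poly"

definition complex_bilinear ::
    "(complex poly \<Rightarrow> 'a::ab_group_add \<Rightarrow> 'a) \<Rightarrow> 'a lambda_map \<Rightarrow> bool" where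
  "complex_bilinear sc w \<longleftrightarrow>
     (\<forall>a. Vector_Spaces.linear (cscale sc) (\<lambda>c. map_poly (cscale sc c)) (\<lambda>b. w a b)) \<and>
     (\<forall>b. Vector_Spaces.linear (cscale sc) (\<lambda>c. map_poly (cscale sc c)) (\<lambda>a. w a b))"

definition conformal_sesquilinear ::
    "(complex poly \<Rightarrow> 'a::ab_group_add \<Rightarrow> 'a) \<Rightarrow> 'a lambda_map \<Rightarrow> bool" where
  "conformal_sesquilinear sc w \<longleftrightarrow>
     (\<forall>a b. w (der sc a) b = - pCons 0 (w a b)) \<and>
     (\<forall>a b. w a (der sc b) = map_poly (der sc) (w a b) + pCons 0 (w a b))"

text \<open>
  \<open>A[\<lambda>,\<mu>]\<close> is represented as \<open>A[\<lambda>][\<mu>]\<close>, i.e. by \<open>'a poly poly\<close> with outer variable \<open>\<mu>\<close>: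
  the coefficient of \<open>\<lambda>\<^sup>i \<mu>\<^sup>j\<close> in \<open>P\<close> is \<open>coeff (coeff P j) i\<close>. As there is no ring
  structure on \<open>A\<close>, the elements \<open>\<lambda>\<close>, \<open>\<mu>\<close> and \<open>\<lambda> + \<mu>\<close> are represented by the multiplication
  operators on \<open>A[\<lambda>,\<mu>]\<close> which they define.
\<close>

type_synonym 'a param = "'a poly poly \<Rightarrow> 'a poly poly"

definition Lam :: "'a::ab_group_add param" where
  "Lam = map_poly (pCons 0)"

definition Mu :: "'a::ab_group_add param" where
  "Mu = pCons 0"

definition LamMu :: "'a::ab_group_add param" where
  "LamMu P = Lam P + Mu P"

text \<open>
  For \<open>p = \<Sum>\<^sub>i x\<^sub>i \<nu>\<^sup>i\<close>, the coefficientwise extension of \<open>F\<close> evaluated at \<open>\<nu> = m\<close> is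
  \<open>\<Sum>\<^sub>i m\<^sup>i F(x\<^sub>i)\<close>; taking for \<open>F\<close> the inclusion of \<open>A\<close> gives the substitution \<open>p(m)\<close>.
\<close>

definition poly_ext ::
    "'a::ab_group_add param \<Rightarrow> ('a \<Rightarrow> 'a poly poly) \<Rightarrow> 'a poly \<Rightarrow> 'a poly poly" where
  "poly_ext m F p = (\<Sum>i\<le>degree p. (m ^^ i) (F (coeff p i)))"

definition at_param :: "'a::ab_group_add param \<Rightarrow> 'a poly \<Rightarrow> 'a poly poly" where
  "at_param m p = poly_ext m (\<lambda>x. [:[:x:]:]) p"

text \<open>
  \<open>nest_left u m v n a b c\<close> is \<open>u\<^sub>m(v\<^sub>n(a,b), c)\<close> and \<open>nest_right u m v n a b c\<close> is
  \<open>u\<^sub>m(a, v\<^sub>n(b,c))\<close>, where \<open>m\<close>, \<open>n\<close> are among \<open>\<lambda>\<close>, \<open>\<mu>\<close>, \<open>\<lambda> + \<mu>\<close>.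
\<close>

definition nest_left ::
    "'a::ab_group_add lambda_map \<Rightarrow> 'a param \<Rightarrow> 'a lambda_map \<Rightarrow> 'a param \<Rightarrow> 'a \<Rightarrow> 'a \<Rightarrow> 'a \<Rightarrow> 'a poly poly"
  where "nest_left u m v n a b c = poly_ext n (\<lambda>x. at_param m (u x c)) (v a b)"

definition nest_right ::
    "'a::ab_group_add lambda_map \<Rightarrow> 'a param \<Rightarrow> 'a lambda_map \<Rightarrow> 'a param \<Rightarrow> 'a \<Rightarrow> 'a \<Rightarrow> 'a \<Rightarrow> 'a poly poly"
  where "nest_right u m v n a b c = poly_ext n (\<lambda>x. at_param m (u a x)) (v b c)"

locale left_symmetric_conformal_algebra = module sc
  for sc :: "complex poly \<Rightarrow> 'a::ab_group_add \<Rightarrow> 'a" +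
  fixes pr :: "'a lambda_map"
  assumes bilinear: "complex_bilinear sc pr"
    and sesquilinear: "conformal_sesquilinear sc pr"
    and left_symmetric:
      "nest_left pr LamMu pr Lam a b c - nest_right pr Lam pr Mu a b c =
       nest_left pr LamMu pr Mu b a c - nest_right pr Mu pr Lam b a c"

definition cochains1 :: "(complex poly \<Rightarrow> 'a::ab_group_add \<Rightarrow> 'a) \<Rightarrow> ('a \<Rightarrow> 'a) set" where
  "cochains1 sc = {\<phi>. module_hom sc sc \<phi>}"

definition cochains2 :: "(complex poly \<Rightarrow> 'a::ab_group_add \<Rightarrow> 'a) \<Rightarrow> 'a lambda_map set" where
  "cochains2 sc = {w. complex_bilinear sc w \<and> conformal_sesquilinear sc w}"

definition diff1 :: "'a::ab_group_add lambda_map \<Rightarrow> ('a \<Rightarrow> 'a) \<Rightarrow> 'a lambda_map" where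
  "diff1 pr \<phi> a b = pr a (\<phi> b) + pr (\<phi> a) b - map_poly \<phi> (pr a b)"

definition diff2 ::
    "'a::ab_group_add lambda_map \<Rightarrow> 'a lambda_map \<Rightarrow> 'a \<Rightarrow> 'a \<Rightarrow> 'a \<Rightarrow> 'a poly poly" where
  "diff2 pr w a b c =
     nest_right pr Lam w Mu a b c
     - nest_right pr Mu w Lam b a c
     + nest_left pr LamMu w Mu b a c
     - nest_left pr LamMu w Lam a b c
     - nest_right w Mu pr Lam b a c
     + nest_right w Lam pr Mu a b c
     - nest_left w LamMu pr Lam a b c
     + nest_left w LamMu pr Mu b a c"

definition cocycles2 ::
    "(complex poly \<Rightarrow> 'a::ab_group_add \<Rightarrow> 'a) \<Rightarrow> 'a lambda_map \<Rightarrow> 'a lambda_map set" where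
  "cocycles2 sc pr = {w \<in> cochains2 sc. \<forall>a b c. diff2 pr w a b c = 0}"

definition coboundaries2 ::
    "(complex poly \<Rightarrow> 'a::ab_group_add \<Rightarrow> 'a) \<Rightarrow> 'a lambda_map \<Rightarrow> 'a lambda_map set" where
  "coboundaries2 sc pr = diff1 pr ` cochains1 sc"

definition cohomologous ::
    "(complex poly \<Rightarrow> 'a::ab_group_add \<Rightarrow> 'a) \<Rightarrow> 'a lambda_map \<Rightarrow> 'a lambda_map rel" where
  "cohomologous sc pr =
     {(w, w'). w \<in> cocycles2 sc pr \<and> w' \<in> cocycles2 sc pr \<and>
       (\<lambda>a b. w a b - w' a b) \<in> coboundaries2 sc pr}"

definition H2 ::
    "(complex poly \<Rightarrow> 'a::ab_group_add \<Rightarrow> 'a) \<Rightarrow> 'a lambda_map \<Rightarrow> 'a lambda_map set set" where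
  "H2 sc pr = cocycles2 sc pr // cohomologous sc pr"

definition coh_class ::
    "(complex poly \<Rightarrow> 'a::ab_group_add \<Rightarrow> 'a) \<Rightarrow> 'a lambda_map \<Rightarrow> 'a lambda_map \<Rightarrow> 'a lambda_map set" where
  "coh_class sc pr w = cohomologous sc pr `` {w}"

text \<open>A formal power series in \<open>t\<close> is represented by the sequence of its coefficients.\<close>

definition formal_deformation ::
    "(complex poly \<Rightarrow> 'a::ab_group_add \<Rightarrow> 'a) \<Rightarrow> 'a lambda_map \<Rightarrow> (nat \<Rightarrow> 'a lambda_map) \<Rightarrow> bool" where
  "formal_deformation sc pr \<theta> \<longleftrightarrow>
     (\<forall>i. \<theta> i \<in> cochains2 sc) \<and> \<theta> 0 = pr \<and>
     (\<forall>n a b c.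
       (\<Sum>(i, j)\<in>{(i, j). i + j = n}.
          nest_left (\<theta> i) LamMu (\<theta> j) Lam a b c - nest_right (\<theta> i) Lam (\<theta> j) Mu a b c) =
       (\<Sum>(i, j)\<in>{(i, j). i + j = n}.
          nest_left (\<theta> i) LamMu (\<theta> j) Mu b a c - nest_right (\<theta> i) Mu (\<theta> j) Lam b a c))"

definition equivalent_deformations ::
    "(complex poly \<Rightarrow> 'a::ab_group_add \<Rightarrow> 'a) \<Rightarrow> (nat \<Rightarrow> 'a lambda_map) \<Rightarrow> (nat \<Rightarrow> 'a lambda_map) \<Rightarrow> bool"
  where
  "equivalent_deformations sc \<theta> \<theta>' \<longleftrightarrow>
     (\<exists>\<phi>. (\<forall>i. \<phi> i \<in> cochains1 sc) \<and> \<phi> 0 = id \<and>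
       (\<forall>n a b.
         (\<Sum>(i, j)\<in>{(i, j). i + j = n}. map_poly (\<phi> i) (\<theta>' j a b)) =
         (\<Sum>(i, j, k)\<in>{(i, j, k). i + j + k = n}. \<theta> i (\<phi> j a) (\<phi> k b))))"

end

theory Submission
  imports Defs
begin

text \<open>Everything is read off from the coefficient of t in the defining identities. There the
  left-symmetry identity of the deformation pairs \<open>pr\<close> with \<open>\<theta> 1\<close>
  in both orders, and its right side minus its left side is the differential of
  \<open>\<theta> 1\<close> (\<open>formal_deformation_infinitesimal_cocycle\<close>). The
  coefficient of t in the morphism identity says that \<open>\<theta>' 1\<close> minus
  \<open>\<theta> 1\<close> is the differential of \<open>\<phi> 1\<close>
  (\<open>equivalent_deformations_infinitesimals\<close>). To pass from a coboundary difference to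
  equality of classes, the relation \<open>cohomologous\<close> must be an equivalence
  (\<open>equiv_cohomologous\<close>); this holds because coboundaries form an additive
  group.\<close>

lemma complex_bilinear_diff:
  assumes "complex_bilinear sc w"
  shows "w (a - a') b = w a b - w a' b" and "w a (b - b') = w a b - w a b'"
proof -
  have "Vector_Spaces.linear (cscale sc) (\<lambda>c. map_poly (cscale sc c)) (\<lambda>a. w a b)"
    and "Vector_Spaces.linear (cscale sc) (\<lambda>c. map_poly (cscale sc c)) (w a)"
    using assms by (auto simp: complex_bilinear_def)
  then have "module_hom (cscale sc) (\<lambda>c. map_poly (cscale sc c)) (\<lambda>a. w a b)"
    and "module_hom (cscale sc) (\<lambda>c. map_poly (cscale sc c)) (w a)"
    by (simp_all add: Vector_Spaces.linear_def)
  then show "w (a - a') b = w a b - w a' b" and "w a (b - b') = w a b - w a b'"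
    by (blast dest: module_hom.diff)+
qed

lemma diff1_diff:
  assumes "complex_bilinear sc pr" "module_hom sc sc \<phi>" "module_hom sc sc \<psi>"
  shows "diff1 pr (\<lambda>x. \<phi> x - \<psi> x) a b = diff1 pr \<phi> a b - diff1 pr \<psi> a b"
proof -
  \<comment> \<open>Beyond the degree of \<open>p\<close> the coefficients agree because module
    homomorphisms send 0 to 0; this is the side condition of \<open>coeff_map_poly\<close>.\<close>
  have "map_poly (\<lambda>x. \<phi> x - \<psi> x) p = map_poly \<phi> p - map_poly \<psi> p" for p
    using assms(2,3)[THEN module_hom.zero] by (simp add: poly_eq_iff coeff_map_poly)
  then show ?thesis
    by (simp add: diff1_def complex_bilinear_diff[OF assms(1)])
qed

text \<open>The differential on 1-cochains is additive. Closure under differences, together with the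
  zero map, is all the group structure used below.\<close>

lemma coboundaries2_diff:
  assumes "complex_bilinear sc pr" "u \<in> coboundaries2 sc pr" "v \<in> coboundaries2 sc pr"
  shows "(\<lambda>a b. u a b - v a b) \<in> coboundaries2 sc pr"
proof -
  obtain \<phi> \<psi> where hom: "module_hom sc sc \<phi>" "module_hom sc sc \<psi>"
    and "u = diff1 pr \<phi>" "v = diff1 pr \<psi>"
    using assms(2,3) by (auto simp: coboundaries2_def cochains1_def)
  then have "(\<lambda>a b. u a b - v a b) = diff1 pr (\<lambda>x. \<phi> x - \<psi> x)"
    using diff1_diff[OF assms(1) hom] by (simp add: fun_eq_iff)
  moreover interpret module_pair sc sc
    using hom(1) by (simp add: module_hom_iff module_pair_def)
  have "module_hom sc sc (\<lambda>x. \<phi> x - \<psi> x)"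
    using hom by (rule module_hom_sub)
  ultimately show ?thesis
    by (auto simp: coboundaries2_def cochains1_def)
qed

lemma zero_in_coboundaries2:
  assumes "module sc" "complex_bilinear sc pr"
  shows "(\<lambda>a b. 0) \<in> coboundaries2 sc pr"
proof -
  \<comment> \<open>Any coboundary will do here, as zero is its difference with itself.\<close>
  have "diff1 pr id \<in> coboundaries2 sc pr"
    using module.module_hom_id[OF assms(1)]
    by (auto simp: coboundaries2_def cochains1_def id_def)
  from coboundaries2_diff[OF assms(2) this this] show ?thesis
    by simp
qed

lemma equiv_cohomologous:
  assumes "module sc" "complex_bilinear sc pr"
  shows "equiv (cocycles2 sc pr) (cohomologous sc pr)"
proof (rule equivI)
  show "cohomologous sc pr \<subseteq> cocycles2 sc pr \<times> cocycles2 sc pr"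
    by (auto simp: cohomologous_def)
  show "refl_on (cocycles2 sc pr) (cohomologous sc pr)"
    using zero_in_coboundaries2[OF assms] by (auto simp: refl_on_def cohomologous_def)
  \<comment> \<open>Negation is obtained as 0 - (u - v).\<close>
  have minus: "(\<lambda>a b. v a b - u a b) \<in> coboundaries2 sc pr"
    if "(\<lambda>a b. u a b - v a b) \<in> coboundaries2 sc pr" for u v
    using coboundaries2_diff[OF assms(2) zero_in_coboundaries2[OF assms] that] by simp
  then show "sym (cohomologous sc pr)"
    by (auto simp: sym_def cohomologous_def)
  show "trans (cohomologous sc pr)"
  proof (rule transI)
    fix u v w
    assume "(u, v) \<in> cohomologous sc pr" "(v, w) \<in> cohomologous sc pr"
    \<comment> \<open>Transitivity by differences alone: u - w = (u - v) - (w - v).\<close>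
    then show "(u, w) \<in> cohomologous sc pr"
      using coboundaries2_diff[OF assms(2), of "\<lambda>a b. u a b - v a b" "\<lambda>a b. w a b - v a b"]
        minus[of v w]
      by (auto simp: cohomologous_def)
  qed
qed

text \<open>For n = 1 only the index pairs (0, 1) and (1, 0) occur, and \<open>\<theta> 0\<close> is
  the product; moving all eight terms to one side gives exactly the terms of
  \<open>diff2\<close>.\<close>

lemma formal_deformation_infinitesimal_cocycle:
  assumes "formal_deformation sc pr \<theta>"
  shows "\<theta> 1 \<in> cocycles2 sc pr"
proof -
  have pairs: "{(i, j). i + j = (1::nat)} = {(0, 1), (1, 0)}"
    by auto
  have "\<theta> 0 = pr" "\<theta> 1 \<in> cochains2 sc"
    using assms by (auto simp: formal_deformation_def)
  moreover have "diff2 pr (\<theta> 1) a b c = 0" for a b c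
  proof -
    have "(\<Sum>(i, j)\<in>{(i, j). i + j = 1}.
          nest_left (\<theta> i) LamMu (\<theta> j) Lam a b c - nest_right (\<theta> i) Lam (\<theta> j) Mu a b c) =
       (\<Sum>(i, j)\<in>{(i, j). i + j = 1}.
          nest_left (\<theta> i) LamMu (\<theta> j) Mu b a c - nest_right (\<theta> i) Mu (\<theta> j) Lam b a c)"
      using assms by (simp only: formal_deformation_def)
    then show ?thesis
      unfolding pairs by (simp add: \<open>\<theta> 0 = pr\<close> diff2_def algebra_simps)
  qed
  ultimately show ?thesis
    by (simp add: cocycles2_def)
qed

text \<open>With \<open>\<phi> 0 = id\<close>, the case n = 1 reads \<theta>'1(a,b) + \<phi>1(ab) =
  \<theta>1(a,b) + \<phi>1(a)b + a\<phi>1(b), so the 1-cochain sought is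
  \<open>\<phi> 1\<close>.\<close>

lemma equivalent_deformations_infinitesimals:
  assumes "equivalent_deformations sc \<theta> \<theta>'" "\<theta> 0 = pr" "\<theta>' 0 = pr"
  shows "(\<lambda>a b. \<theta>' 1 a b - \<theta> 1 a b) \<in> coboundaries2 sc pr"
proof -
  obtain \<phi> where \<phi>: "\<And>i. \<phi> i \<in> cochains1 sc" "\<phi> 0 = id"
    and eq: "\<And>n a b. (\<Sum>(i, j)\<in>{(i, j). i + j = n}. map_poly (\<phi> i) (\<theta>' j a b)) =
         (\<Sum>(i, j, k)\<in>{(i, j, k). i + j + k = n}. \<theta> i (\<phi> j a) (\<phi> k b))"
    using assms(1) by (auto simp: equivalent_deformations_def)
  have pairs: "{(i, j). i + j = (1::nat)} = {(0, 1), (1, 0)}"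
    and triples: "{(i, j, k). i + j + k = (1::nat)} = {(1, 0, 0), (0, 1, 0), (0, 0, 1)}"
    by auto
  have "\<theta>' 1 a b - \<theta> 1 a b = diff1 pr (\<phi> 1) a b" for a b
    using eq[where n = 1 and a = a and b = b] unfolding pairs triples
    by (simp add: \<phi>(2) assms(2,3) map_poly_id diff1_def algebra_simps)
  then have "(\<lambda>a b. \<theta>' 1 a b - \<theta> 1 a b) = diff1 pr (\<phi> 1)"
    by (simp add: fun_eq_iff)
  then show ?thesis
    using \<phi>(1) by (auto simp: coboundaries2_def)
qed

theorem theorem5p5:
  fixes sc :: "complex poly \<Rightarrow> 'a::ab_group_add \<Rightarrow> 'a"
    and pr :: "'a lambda_map"
    and \<theta> :: "nat \<Rightarrow> 'a lambda_map"
  assumes "left_symmetric_conformal_algebra sc pr"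
    and "fin_gen_module sc"
    and "formal_deformation sc pr \<theta>"
  shows "\<theta> 1 \<in> cocycles2 sc pr \<and>
    (\<forall>\<theta>'. formal_deformation sc pr \<theta>' \<and> equivalent_deformations sc \<theta> \<theta>' \<longrightarrow>
       coh_class sc pr (\<theta> 1) \<in> H2 sc pr \<and>
       coh_class sc pr (\<theta>' 1) \<in> H2 sc pr \<and>
       coh_class sc pr (\<theta> 1) = coh_class sc pr (\<theta>' 1))"
proof (intro conjI allI impI)
  interpret left_symmetric_conformal_algebra sc pr
    by (rule assms(1))
  note equiv = equiv_cohomologous[OF module_axioms bilinear]
  show cocycle: "\<theta> 1 \<in> cocycles2 sc pr"
    using assms(3) by (rule formal_deformation_infinitesimal_cocycle)
  then show "coh_class sc pr (\<theta> 1) \<in> H2 sc pr"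
    by (simp add: coh_class_def H2_def quotientI)
  fix \<theta>'
  assume \<theta>': "formal_deformation sc pr \<theta>' \<and> equivalent_deformations sc \<theta> \<theta>'"
  then have cocycle': "\<theta>' 1 \<in> cocycles2 sc pr"
    by (blast intro: formal_deformation_infinitesimal_cocycle)
  then show "coh_class sc pr (\<theta>' 1) \<in> H2 sc pr"
    by (simp add: coh_class_def H2_def quotientI)
  have "\<theta> 0 = pr" "\<theta>' 0 = pr"
    using assms(3) \<theta>' by (auto simp: formal_deformation_def)
  \<comment> \<open>The order of the pair follows the direction of the morphism, from
    \<open>\<theta>'\<close> to \<open>\<theta>\<close>.\<close>
  then have "(\<theta>' 1, \<theta> 1) \<in> cohomologous sc pr"
    using equivalent_deformations_infinitesimals \<theta>' cocycle cocycle'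
    by (auto simp: cohomologous_def)
  then show "coh_class sc pr (\<theta> 1) = coh_class sc pr (\<theta>' 1)"
    using equiv_class_eq[OF equiv] by (simp add: coh_class_def)
qed

end
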